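(* For every integer $n\ge 3$ and every real number $\varepsilon>0$, there exist velocity functions $\nu_1,\dots,\nu_n$ of $n$ innocent runners on the unit circle $\mathbb{R}/\mathbb{Z}$ such that, if all runners start at the same point at time $0$, then at every time $s>0$ and for every runner who is neither the slowest nor the fastest, there exists another runner at distance at most $\varepsilon$ from that runner at time $s$. That is, for every $s>0$ and every $i\in\{2,\dots,n-1\}$ there exists $j\in\{1,\dots,n\}\setminus\{i\}$ with $$\left\|\int_0^s \bigl(\nu_j(t)-\nu_i(t)\bigr)\,dt\right\|_{\mathbb{R}/\mathbb{Z}} \le \varepsilon.$$
   Context: For $x\in\mathbb{R}$, $\|x\|_{\mathbb{R}/\mathbb{Z}}$ denotes the distance from $x$ to the nearest integer. Runners are indexed by $\{1,\dots,n\}$, and runner $i$ has a velocity function $\nu_i\in L^1_{\mathrm{loc}}(\mathbb{R}_{>0})$, where local integrability includes integrability near $0$, i.e. $\int_0^s|\nu_i(t)|\,dt<\infty$ for every $s>0$. When all runners start at the same point, the position of runner $i$ at time $s$ is $\int_0^s\nu_i(t)\,dt$ modulo $1$ (up to a common translation), and the distance between runners $i$ and $j$ at time $s$ is $\left\|\int_0^s(\nu_j(t)-\nu_i(t))\,dt\right\|_{\mathbb{R}/\mathbb{Z}}$. The $n$ runners are called innocent if (i) $\nu_1<\nu_2<\cdots<\nu_n$ almost everywhere on $\mathbb{R}_{>0}$, and (ii) for every $1\le i<j\le n$, $\int_0^\infty(\nu_j(t)-\nu_i(t))\,dt=\infty$. *)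

theory Defs
  imports "HOL-Analysis.Analysis"
begin

definition dist_to_Ints :: "real \<Rightarrow> real" where
  "dist_to_Ints x = infdist x \<int>"

text \<open>
  A velocity function on the positive half-line is represented by a function on all reals whose
  values at non-positive arguments are irrelevant. Integrability is required on every \<open>(0, s]\<close>,
  hence also near \<open>0\<close>.
\<close>

definition locally_L1 :: "(real \<Rightarrow> real) \<Rightarrow> bool" where
  "locally_L1 f \<longleftrightarrow> (\<forall>s>0. set_integrable lebesgue {0<..s} f)"

text \<open>
  In the last clause the integral over the half-line is that of a function which is positive almost
  everywhere by the second clause, so the truncation of negative values by \<^term>\<open>ennreal\<close> is
  harmless.
\<close>

definition innocent_runners :: "nat \<Rightarrow> (nat \<Rightarrow> real \<Rightarrow> real) \<Rightarrow> bool" where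
  "innocent_runners n \<nu> \<longleftrightarrow>
     (\<forall>i\<in>{1..n}. locally_L1 (\<nu> i)) \<and>
     (AE t in lebesgue. t > 0 \<longrightarrow> strict_mono_on {1..n} (\<lambda>i. \<nu> i t)) \<and>
     (\<forall>i\<in>{1..n}. \<forall>j\<in>{1..n}. i < j \<longrightarrow>
        (\<integral>\<^sup>+t\<in>{0<..}. ennreal (\<nu> j t - \<nu> i t) \<partial>lebesgue) = \<infinity>)"

end

theory Submission
  imports Defs
begin

text \<open>
  In the frame of the slowest runner, let the odd runners \<open>1, 3, 5, \<dots>\<close> move at the constant
  speeds \<open>0, 1, 2, \<dots>\<close>, and let every even runner have the speed of the next odd runner minus a
  common function with values strictly between 0 and 1. Then each gap between consecutive
  runners is one of only two functions of time: \<open>A\<close>, if the slower runner of the two is even,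
  and \<open>B\<close>, if the slower runner is odd. A runner who is neither slowest nor fastest has a gap
  of each kind, one to each neighbour, so it suffices that at every time \<open>A\<close> or \<open>B\<close> is within
  \<open>\<epsilon>\<close> of an integer.

  Since \<open>A(s) + B(s) = s\<close>, only \<open>A\<close> has to be chosen. The two gaps take turns: in odd-numbered unit
  time intervals \<open>A\<close> creeps forward by \<open>\<delta> \<le> \<epsilon>\<close> while \<open>B\<close> advances by \<open>1 - \<delta>\<close>, and in
  even-numbered ones the roles are exchanged. Each gap grows by exactly 1 in every two intervals,
  so both are integers at even times. A creeping gap is therefore close to an integer, being either
  at the beginning or at the end of its lap (\<open>step_speed_integral_near_Ints\<close>). Both speeds are at
  least \<open>\<delta> > 0\<close>, which makes the velocities strictly ordered and all gaps unbounded.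
\<close>

section \<open>Two gaps that take turns at making a lap\<close>

text \<open>
  Rounding up makes the speed constant on the half-open intervals \<open>(m, m + 1]\<close>, which
  tile \<open>(0, s]\<close> without exceptional points.
\<close>

definition step_speed :: "real \<Rightarrow> real \<Rightarrow> real" where
  "step_speed \<delta> t = (if odd \<lceil>t\<rceil> then \<delta> else 1 - \<delta>)"

lemma step_speed_bounds:
  assumes "0 < \<delta>" "\<delta> \<le> 1/2"
  shows "\<delta> \<le> step_speed \<delta> t" "step_speed \<delta> t \<le> 1 - \<delta>"
  using assms by (auto simp: step_speed_def)

lemma step_speed_measurable: "step_speed \<delta> \<in> borel_measurable lebesgue"
proof -
  have "step_speed \<delta> \<in> borel_measurable borel"
    unfolding step_speed_def by measurable
  then show ?thesis
    by (simp add: measurable_completion)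
qed

lemma emeasure_Ioc_finite:
  fixes a b :: real
  shows "emeasure lebesgue {a<..b} < \<infinity>"
  using emeasure_bounded_finite[of "{a<..b}"] by simp

lemma set_integrable_const_Ioc:
  fixes a b c :: real
  shows "set_integrable lebesgue {a<..b} (\<lambda>t. c)"
  using emeasure_Ioc_finite[of a b] by (simp add: set_integrable_def integrable_indicator_iff)

lemma set_integrable_step_speed: "set_integrable lebesgue {a<..b} (step_speed \<delta>)"
  unfolding set_integrable_def
proof (rule integrableI_bounded_set_indicator)
  show "AE t in lebesgue. t \<in> {a<..b} \<longrightarrow> norm (step_speed \<delta> t) \<le> \<bar>\<delta>\<bar> + \<bar>1 - \<delta>\<bar>"
    by (auto simp: step_speed_def)
qed (use emeasure_Ioc_finite[of a b] in \<open>auto simp: step_speed_measurable\<close>)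

lemma set_integral_const_Ioc:
  "a \<le> b \<Longrightarrow> (LINT t:{a<..b}|lebesgue. (c :: real)) = c * (b - a)"
  by (simp add: set_integral_const)

lemma step_speed_integral_step:
  assumes "real m \<le> s" "s \<le> real m + 1"
  shows "(LINT t:{0<..s}|lebesgue. step_speed \<delta> t) =
    (LINT t:{0<..real m}|lebesgue. step_speed \<delta> t) + (if even m then \<delta> else 1 - \<delta>) * (s - real m)"
proof -
  have "{0<..s} = {0<..real m} \<union> {real m<..s}"
    using assms by auto
  then have "(LINT t:{0<..s}|lebesgue. step_speed \<delta> t) =
    (LINT t:{0<..real m}|lebesgue. step_speed \<delta> t) + (LINT t:{real m<..s}|lebesgue. step_speed \<delta> t)"
    by (simp add: set_integral_Un set_integrable_step_speed)
  also have "(LINT t:{real m<..s}|lebesgue. step_speed \<delta> t) =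
      (LINT t:{real m<..s}|lebesgue. if even m then \<delta> else 1 - \<delta>)"
  proof (rule set_lebesgue_integral_cong)
    show "\<forall>t. t \<in> {real m<..s} \<longrightarrow> step_speed \<delta> t = (if even m then \<delta> else 1 - \<delta>)"
    proof (intro allI impI)
      fix t assume "t \<in> {real m<..s}"
      then have "\<lceil>t\<rceil> = int m + 1"
        using assms by (simp add: ceiling_eq_iff)
      then show "step_speed \<delta> t = (if even m then \<delta> else 1 - \<delta>)"
        by (simp add: step_speed_def)
    qed
  qed auto
  also have "\<dots> = (if even m then \<delta> else 1 - \<delta>) * (s - real m)"
    using assms(1) by (rule set_integral_const_Ioc)
  finally show ?thesis .
qed

lemma step_speed_integral_even:
  "(LINT t:{0<..real (2 * k)}|lebesgue. step_speed \<delta> t) = real k"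
proof (induction k)
  case 0
  then show ?case by (simp add: set_lebesgue_integral_def)
next
  case (Suc k)
  have "(LINT t:{0<..real (2 * k + 1)}|lebesgue. step_speed \<delta> t) = real k + \<delta>"
    using step_speed_integral_step[of "2 * k" "real (2 * k + 1)" \<delta>] Suc by simp
  then show ?case
    using step_speed_integral_step[of "2 * k + 1" "real (2 * Suc k)" \<delta>] by simp
qed

text \<open>
  While the interval number \<open>m\<close> (counted from 0) is even, the integral creeps upwards from an
  integer; while \<open>m\<close> is odd, the complementary integral creeps upwards to an integer.
\<close>

lemma step_speed_integral_near_Ints:
  fixes s \<delta> :: real
  assumes "0 < \<delta>" "\<delta> \<le> 1/2" "0 < s"
  defines "A \<equiv> LINT t:{0<..s}|lebesgue. step_speed \<delta> t"
  shows "\<exists>k::int. \<bar>A - k\<bar> \<le> \<delta> \<or> \<bar>(s - A) - k\<bar> \<le> \<delta>"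
proof -
  define m where "m = nat \<lfloor>s\<rfloor>"
  have m: "real m \<le> s" "s \<le> real m + 1"
    using assms(3) unfolding m_def by linarith+
  show ?thesis
  proof (cases "even m")
    case True
    then obtain k where k: "m = 2 * k" by blast
    have A: "A = k + \<delta> * (s - real m)"
      using step_speed_integral_step[OF m, of \<delta>] step_speed_integral_even[of k \<delta>]
      by (simp add: A_def k)
    have "0 \<le> \<delta> * (s - real m)" "\<delta> * (s - real m) \<le> \<delta> * 1"
      using m assms(1) by (auto intro!: mult_left_mono)
    then have "\<bar>A - of_int (int k)\<bar> \<le> \<delta>"
      by (simp add: A)
    then show ?thesis by blast
  next
    case False
    then obtain k where k: "m = 2 * k + 1" by (blast elim: oddE)
    have "(LINT t:{0<..real m}|lebesgue. step_speed \<delta> t) = k + \<delta>"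
      using step_speed_integral_step[of "2 * k" "real m" \<delta>] step_speed_integral_even[of k \<delta>]
      by (simp add: k)
    then have A: "A = k + \<delta> + (1 - \<delta>) * (s - real m)"
      using step_speed_integral_step[OF m, of \<delta>] False by (simp add: A_def)
    have "0 \<le> \<delta> * (real m + 1 - s)" "\<delta> * (real m + 1 - s) \<le> \<delta> * 1"
      using m assms(1) by (auto intro!: mult_left_mono)
    moreover have "(s - A) - of_int (int k + 1) = - (\<delta> * (real m + 1 - s))"
      by (simp add: A k algebra_simps)
    ultimately have "\<bar>(s - A) - of_int (int k + 1)\<bar> \<le> \<delta>"
      by linarith
    then show ?thesis by blast
  qed
qed

lemma dist_to_Ints_le:
  assumes "\<bar>x - of_int k\<bar> \<le> e"
  shows "dist_to_Ints x \<le> e" "dist_to_Ints (- x) \<le> e"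
proof -
  have near: "dist_to_Ints y \<le> \<bar>y - of_int l\<bar>" for y l
    unfolding dist_to_Ints_def using infdist_le[of "of_int l" \<int> y] by (simp add: dist_real_def)
  show "dist_to_Ints x \<le> e"
    using near[of x k] assms by linarith
  show "dist_to_Ints (- x) \<le> e"
    using near[of "- x" "- k"] assms by simp
qed

section \<open>The runners\<close>

definition runner_speed :: "real \<Rightarrow> nat \<Rightarrow> real \<Rightarrow> real" where
  "runner_speed \<delta> i t = real (i div 2) - (if even i then step_speed \<delta> t else 0)"

text \<open>
  The whole-number part \<open>i div 2\<close> grows by at least 1 from runner \<open>i\<close> to runner \<open>j\<close>, which
  outweighs a possible loss of at most \<open>1 - \<delta>\<close>. Only when \<open>i\<close> is even and \<open>j\<close> is odd can it
  stay the same, and then the difference contains the term \<open>step_speed \<delta> t \<ge> \<delta>\<close>.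
\<close>

lemma runner_speed_gap:
  assumes "0 < \<delta>" "\<delta> \<le> 1/2" "i < j"
  shows "\<delta> \<le> runner_speed \<delta> j t - runner_speed \<delta> i t"
proof -
  have b: "\<delta> \<le> step_speed \<delta> t" "step_speed \<delta> t \<le> 1 - \<delta>"
    using step_speed_bounds assms by auto
  have "real (i div 2) \<le> real (j div 2)"
    using assms(3) by (simp add: div_le_mono)
  moreover have "real (i div 2) + 1 \<le> real (j div 2)" if "odd i \<or> even j"
  proof -
    have "i div 2 + 1 \<le> j div 2"
      using assms(3) that by presburger
    then show ?thesis by linarith
  qed
  ultimately show ?thesis
    using b assms(1,2) unfolding runner_speed_def by (cases "even i"; cases "even j"; simp)
qed

lemma emeasure_half_line: "emeasure lebesgue {0 :: real<..} = \<infinity>"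
proof (rule ccontr)
  assume "emeasure lebesgue {0 :: real<..} \<noteq> \<infinity>"
  then obtain m :: nat where m: "emeasure lebesgue {0 :: real<..} < of_nat m"
    using ennreal_Ex_less_of_nat by (auto simp: less_top)
  have "of_nat m = emeasure lebesgue {0<..real m}"
    by (simp add: ennreal_of_nat_eq_real_of_nat)
  also have "\<dots> \<le> emeasure lebesgue {0 :: real<..}"
    by (rule emeasure_mono) auto
  finally show False
    using m by simp
qed

lemma innocent_runner_speed:
  assumes "0 < \<delta>" "\<delta> \<le> 1/2"
  shows "innocent_runners n (runner_speed \<delta>)"
  unfolding innocent_runners_def
proof (intro conjI ballI impI)
  fix i
  show "locally_L1 (runner_speed \<delta> i)"
    unfolding locally_L1_def runner_speed_def
    by (cases "even i") (auto intro!: set_integrable_const_Ioc set_integrable_step_speed)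
next
  have "strict_mono_on {1..n} (\<lambda>i. runner_speed \<delta> i t)" for t
  proof (rule strict_mono_onI)
    fix i j :: nat
    assume "i < j"
    with runner_speed_gap[OF assms, of i j t] assms(1)
    show "runner_speed \<delta> i t < runner_speed \<delta> j t" by linarith
  qed
  then show "AE t in lebesgue. t > 0 \<longrightarrow> strict_mono_on {1..n} (\<lambda>i. runner_speed \<delta> i t)"
    by simp
next
  fix i j :: nat
  assume "i < j"
  have "\<infinity> = (\<integral>\<^sup>+t\<in>{0 :: real<..}. ennreal \<delta> \<partial>lebesgue)"
    using assms(1) by (simp add: nn_integral_cmult_indicator emeasure_half_line ennreal_mult_top)
  also have "\<dots> \<le> (\<integral>\<^sup>+t\<in>{0<..}. ennreal (runner_speed \<delta> j t - runner_speed \<delta> i t) \<partial>lebesgue)"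
    by (intro nn_integral_mono mult_right_mono ennreal_leI runner_speed_gap assms \<open>i < j\<close>) simp
  finally show "(\<integral>\<^sup>+t\<in>{0<..}. ennreal (runner_speed \<delta> j t - runner_speed \<delta> i t) \<partial>lebesgue) = \<infinity>"
    by (simp add: top_unique)
qed

lemma runner_gap_integral:
  fixes s \<delta> :: real
  assumes "0 \<le> s"
  defines "A \<equiv> LINT t:{0<..s}|lebesgue. step_speed \<delta> t"
  shows "(LINT t:{0<..s}|lebesgue. (runner_speed \<delta> (Suc i) t - runner_speed \<delta> i t)) =
    (if even i then A else s - A)"
proof (cases "even i")
  case True
  then have "runner_speed \<delta> (Suc i) t - runner_speed \<delta> i t = step_speed \<delta> t" for t
    by (simp add: runner_speed_def)
  with True show ?thesis by (simp add: A_def)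
next
  case False
  then have "runner_speed \<delta> (Suc i) t - runner_speed \<delta> i t = 1 - step_speed \<delta> t" for t
    by (auto simp: runner_speed_def elim!: oddE)
  with False show ?thesis
    using assms(1)
    by (simp add: A_def set_integral_diff set_integrable_const_Ioc set_integrable_step_speed
        set_integral_const_Ioc)
qed

theorem theorem1p5:
  fixes n :: nat and \<epsilon> :: real
  assumes "n \<ge> 3" and "\<epsilon> > 0"
  shows "\<exists>\<nu> :: nat \<Rightarrow> real \<Rightarrow> real. innocent_runners n \<nu> \<and>
    (\<forall>s>0. \<forall>i\<in>{2..n-1}. \<exists>j\<in>{1..n} - {i}.
       dist_to_Ints (LINT t:{0<..s}|lebesgue. (\<nu> j t - \<nu> i t)) \<le> \<epsilon>)"
proof -
  define \<delta> where "\<delta> = min \<epsilon> (1/2)"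
  have \<delta>: "0 < \<delta>" "\<delta> \<le> 1/2" "\<delta> \<le> \<epsilon>"
    using assms(2) by (auto simp: \<delta>_def)
  have "\<exists>j\<in>{1..n} - {i}.
      dist_to_Ints (LINT t:{0<..s}|lebesgue. (runner_speed \<delta> j t - runner_speed \<delta> i t)) \<le> \<epsilon>"
    if s: "s > 0" and i: "i \<in> {2..n-1}" for s i
  proof -
    define gap where
      "gap k = (LINT t:{0<..s}|lebesgue. (runner_speed \<delta> (Suc k) t - runner_speed \<delta> k t))" for k
    define A where "A = (LINT t:{0<..s}|lebesgue. step_speed \<delta> t)"
    have Suc_pred: "Suc (i - 1) = i"
      using i by simp
    have parity: "even (i - 1) \<longleftrightarrow> odd i"
      using i by auto
    have gap: "gap k = (if even k then A else s - A)" for k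
      unfolding gap_def A_def by (rule runner_gap_integral) (use s in simp)
    \<comment> \<open>\<open>i\<close> and \<open>i - 1\<close> have opposite parity, so the gaps ahead of and behind runner \<open>i\<close>
        are \<open>A\<close> and \<open>s - A\<close> in some order.\<close>
    have "\<exists>k::int. \<bar>gap i - k\<bar> \<le> \<delta> \<or> \<bar>gap (i - 1) - k\<bar> \<le> \<delta>"
      using step_speed_integral_near_Ints[OF \<delta>(1,2) s] parity
      unfolding gap A_def by (cases "even i") (simp_all only: if_True if_False not_True_eq_False not_False_eq_True, metis+)
    then obtain k :: int where "\<bar>gap i - k\<bar> \<le> \<delta> \<or> \<bar>gap (i - 1) - k\<bar> \<le> \<delta>" ..
    then show ?thesis
    proof
      assume "\<bar>gap i - k\<bar> \<le> \<delta>"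
      then have "dist_to_Ints (gap i) \<le> \<epsilon>"
        by (intro dist_to_Ints_le(1)[of _ k] order_trans[OF _ \<delta>(3)])
      then show ?thesis
        using i unfolding gap_def by (intro bexI[of _ "Suc i"]) auto
    next
      assume "\<bar>gap (i - 1) - k\<bar> \<le> \<delta>"
      then have "dist_to_Ints (- gap (i - 1)) \<le> \<epsilon>"
        by (intro dist_to_Ints_le(2)[of _ k] order_trans[OF _ \<delta>(3)])
      also have "- gap (i - 1) =
          (LINT t:{0<..s}|lebesgue. (runner_speed \<delta> (i - 1) t - runner_speed \<delta> i t))"
        unfolding gap_def Suc_pred set_lebesgue_integral_def
        by (subst integral_minus[symmetric]) (simp add: algebra_simps)
      finally show ?thesis
        using i by (intro bexI[of _ "i - 1"]) auto
    qed
  qed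
  then show ?thesis
    using innocent_runner_speed[OF \<delta>(1,2)] by blast
qed

end
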